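(* Let $\mathbb K$ be $\mathbb H$ or $\mathbb O$. The $\mathscr E_{\mathbb K}^+$-logarithm $$L:\mathscr E_{\mathbb K}^+\to\mathbb K,\qquad L(q,p)=\log|q|+p,$$ is the inverse of the $\mathscr E_{\mathbb K}^+$-exponential $E:\mathbb K\to\mathscr E_{\mathbb K}^+$, $E(x+Iy)=(\exp x\cos y+I\exp x\sin y,\ Iy)$, and is a diffeomorphism from $\mathscr E_{\mathbb K}^+$ to $\mathbb K$.
   Context: $\mathbb K$ is the division algebra of quaternions $\mathbb H$ or octonions $\mathbb O$, identified with $\mathbb R^{\dim\mathbb K}$; $\operatorname{Im}(\mathbb K)$ is the space of purely imaginary elements; $\mathbb S=\{I\in\mathbb K: I^2=-1\}$; every $q\in\mathbb K$ can be written $q=x+Iy$ with $x,y\in\mathbb R$, $I\in\mathbb S$. $\log$ is the real logarithm. The logarithm manifold $\mathscr E_{\mathbb K}^+\subset\mathbb K\times\operatorname{Im}(\mathbb K)$ is the image $f(\mathbb K^+)$ of $\mathbb K^+=\{q\in\mathbb K:\operatorname{Re}q>0\}$ under the map $f(x+Iy)=(\sinh x\cos y+I\sinh x\sin y,\ Iy)$; its elements are the pairs $(q,p)$ with $q=r\exp p$, $r=|q|>0$, $p\in\operatorname{Im}(\mathbb K)$. It is an embedded submanifold whose manifold structure is the one for which $E$ is a diffeomorphism from $\mathbb K$ onto $\mathscr E_{\mathbb K}^+$ (this agrees with the submanifold structure from $\mathbb K\times\operatorname{Im}(\mathbb K)$). *)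

theory Defs
  imports "HOL-Analysis.Analysis"
begin

section \<open>Normed division algebras\<close>

text \<open>Multiplication is not assumed to be associative.  By Hurwitz's theorem the instances of this
  class are, up to isomorphism, the reals, the complex numbers, the quaternions and the octonions,
  so that the class instances below certify the two multiplication tables.\<close>

class normed_division_algebra = euclidean_space + one + times +
  assumes nda_add_mult: "(x + y) * z = x * z + y * z"
    and nda_mult_add: "x * (y + z) = x * y + x * z"
    and nda_scaleR_mult: "(a *\<^sub>R x) * y = a *\<^sub>R (x * y)"
    and nda_mult_scaleR: "x * (a *\<^sub>R y) = a *\<^sub>R (x * y)"
    and nda_one_mult: "1 * x = x"
    and nda_mult_one: "x * 1 = x"
    and nda_norm_mult: "norm (x * y) = norm x * norm y"

subsection \<open>Quaternions\<close>

codatatype quat = Quat (qr: real) (qi: real) (qj: real) (qk: real)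

lemma quat_eq_iff: "x = y \<longleftrightarrow> qr x = qr y \<and> qi x = qi y \<and> qj x = qj y \<and> qk x = qk y"
  by (auto intro: quat.expand)

instantiation quat :: real_vector
begin

primcorec zero_quat where "qr 0 = 0" | "qi 0 = 0" | "qj 0 = 0" | "qk 0 = 0"
primcorec plus_quat where
  "qr (x + y) = qr x + qr y" | "qi (x + y) = qi x + qi y"
| "qj (x + y) = qj x + qj y" | "qk (x + y) = qk x + qk y"
primcorec uminus_quat where
  "qr (- x) = - qr x" | "qi (- x) = - qi x" | "qj (- x) = - qj x" | "qk (- x) = - qk x"
primcorec minus_quat where
  "qr (x - y) = qr x - qr y" | "qi (x - y) = qi x - qi y"
| "qj (x - y) = qj x - qj y" | "qk (x - y) = qk x - qk y"
primcorec scaleR_quat where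
  "qr (scaleR a x) = a * qr x" | "qi (scaleR a x) = a * qi x"
| "qj (scaleR a x) = a * qj x" | "qk (scaleR a x) = a * qk x"

instance
  by standard (simp_all add: quat_eq_iff algebra_simps)

end

instantiation quat :: real_inner
begin

definition inner_quat :: "quat \<Rightarrow> quat \<Rightarrow> real" where
  "inner_quat x y = qr x * qr y + qi x * qi y + qj x * qj y + qk x * qk y"
definition norm_quat :: "quat \<Rightarrow> real" where "norm_quat x = sqrt (inner x x)"
definition sgn_quat :: "quat \<Rightarrow> quat" where "sgn_quat x = x /\<^sub>R norm x"
definition dist_quat :: "quat \<Rightarrow> quat \<Rightarrow> real" where "dist_quat x y = norm (x - y)"
definition uniformity_quat :: "(quat \<times> quat) filter" where
  "uniformity_quat = (INF e\<in>{0<..}. principal {(x, y). dist x y < e})"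
definition open_quat :: "quat set \<Rightarrow> bool" where
  "open_quat U \<longleftrightarrow> (\<forall>x\<in>U. eventually (\<lambda>(x', y). x' = x \<longrightarrow> y \<in> U) uniformity)"

instance
proof
  fix x :: quat
  show "0 \<le> inner x x"
    by (simp add: inner_quat_def)
  have "0 \<le> qr x * qr x" "0 \<le> qi x * qi x" "0 \<le> qj x * qj x" "0 \<le> qk x * qk x"
    by simp_all
  then show "inner x x = 0 \<longleftrightarrow> x = 0"
    by (simp add: inner_quat_def quat_eq_iff add_nonneg_eq_0_iff)
qed (auto simp: quat_eq_iff inner_quat_def norm_quat_def sgn_quat_def dist_quat_def
      uniformity_quat_def open_quat_def algebra_simps)

end

instantiation quat :: "{one, times}"
begin

primcorec one_quat where "qr 1 = 1" | "qi 1 = 0" | "qj 1 = 0" | "qk 1 = 0"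
primcorec times_quat where
  "qr (x * y) = qr x * qr y - qi x * qi y - qj x * qj y - qk x * qk y"
| "qi (x * y) = qr x * qi y + qi x * qr y + qj x * qk y - qk x * qj y"
| "qj (x * y) = qr x * qj y - qi x * qk y + qj x * qr y + qk x * qi y"
| "qk (x * y) = qr x * qk y + qi x * qj y - qj x * qi y + qk x * qr y"

instance ..

end

instantiation quat :: normed_division_algebra
begin

definition Basis_quat :: "quat set" where
  "Basis_quat = {Quat 1 0 0 0, Quat 0 1 0 0, Quat 0 0 1 0, Quat 0 0 0 1}"

instance
proof
  fix x y :: quat
  show "norm (x * y) = norm x * norm y"
    by (simp add: norm_quat_def inner_quat_def flip: real_sqrt_mult) (simp add: algebra_simps)
  show "(\<forall>u\<in>Basis. inner x u = 0) \<longleftrightarrow> x = 0"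
    by (simp add: Basis_quat_def inner_quat_def) (simp add: quat_eq_iff conj_ac)
qed (auto simp: quat_eq_iff inner_quat_def Basis_quat_def algebra_simps)

end

lemma DIM_quat: "DIM(quat) = 4"
  by (simp add: Basis_quat_def)

primcorec qcnj :: "quat \<Rightarrow> quat" where
  "qr (qcnj x) = qr x" | "qi (qcnj x) = - qi x" | "qj (qcnj x) = - qj x" | "qk (qcnj x) = - qk x"

subsection \<open>Octonions\<close>

text \<open>The Cayley--Dickson double of the quaternions.\<close>

codatatype octo = Octo (ofst: quat) (osnd: quat)

lemma octo_eq_iff: "x = y \<longleftrightarrow> ofst x = ofst y \<and> osnd x = osnd y"
  by (auto intro: octo.expand)

instantiation octo :: real_vector
begin

primcorec zero_octo where "ofst 0 = 0" | "osnd 0 = 0"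
primcorec plus_octo where "ofst (x + y) = ofst x + ofst y" | "osnd (x + y) = osnd x + osnd y"
primcorec uminus_octo where "ofst (- x) = - ofst x" | "osnd (- x) = - osnd x"
primcorec minus_octo where "ofst (x - y) = ofst x - ofst y" | "osnd (x - y) = osnd x - osnd y"
primcorec scaleR_octo where
  "ofst (scaleR a x) = a *\<^sub>R ofst x" | "osnd (scaleR a x) = a *\<^sub>R osnd x"

instance
  by standard (simp_all add: octo_eq_iff scaleR_add_left scaleR_add_right)

end

instantiation octo :: real_inner
begin

definition inner_octo :: "octo \<Rightarrow> octo \<Rightarrow> real" where
  "inner_octo x y = inner (ofst x) (ofst y) + inner (osnd x) (osnd y)"
definition norm_octo :: "octo \<Rightarrow> real" where "norm_octo x = sqrt (inner x x)"
definition sgn_octo :: "octo \<Rightarrow> octo" where "sgn_octo x = x /\<^sub>R norm x"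
definition dist_octo :: "octo \<Rightarrow> octo \<Rightarrow> real" where "dist_octo x y = norm (x - y)"
definition uniformity_octo :: "(octo \<times> octo) filter" where
  "uniformity_octo = (INF e\<in>{0<..}. principal {(x, y). dist x y < e})"
definition open_octo :: "octo set \<Rightarrow> bool" where
  "open_octo U \<longleftrightarrow> (\<forall>x\<in>U. eventually (\<lambda>(x', y). x' = x \<longrightarrow> y \<in> U) uniformity)"

instance
  by standard (auto simp: octo_eq_iff inner_octo_def norm_octo_def sgn_octo_def dist_octo_def
      uniformity_octo_def open_octo_def inner_add_left inner_add_right inner_commute
      distrib_left add_nonneg_eq_0_iff)

end

instantiation octo :: "{one, times}"
begin

primcorec one_octo where "ofst 1 = 1" | "osnd 1 = 0"
primcorec times_octo where
  "ofst (x * y) = ofst x * ofst y - qcnj (osnd y) * osnd x"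
| "osnd (x * y) = osnd y * ofst x + osnd x * qcnj (ofst y)"

instance ..

end

instantiation octo :: normed_division_algebra
begin

definition Basis_octo :: "octo set" where
  "Basis_octo = (\<lambda>b. Octo b 0) ` Basis \<union> (\<lambda>b. Octo 0 b) ` Basis"

instance
proof
  fix x y :: octo
  show "norm (x * y) = norm x * norm y"
    by (simp add: norm_octo_def inner_octo_def inner_quat_def flip: real_sqrt_mult)
      (simp add: algebra_simps)
  show "(\<forall>u\<in>Basis. inner x u = 0) \<longleftrightarrow> x = 0"
    by (auto simp: Basis_octo_def inner_octo_def octo_eq_iff ball_Un
        simp flip: euclidean_all_zero_iff[where 'a=quat])
next
  fix u v :: octo
  assume "u \<in> Basis" "v \<in> Basis"
  then show "inner u v = (if u = v then 1 else 0)"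
    by (auto simp: Basis_octo_def inner_octo_def inner_Basis split: if_splits)
qed (auto simp: octo_eq_iff quat_eq_iff Basis_octo_def algebra_simps)

end

lemma DIM_octo: "DIM(octo) = 8"
proof -
  have "card ((\<lambda>b. Octo b 0) ` (Basis :: quat set)) = 4"
       "card (Octo 0 ` (Basis :: quat set)) = 4"
    by (simp_all add: card_image inj_on_def DIM_quat)
  moreover have "(\<lambda>b. Octo b 0) ` Basis \<inter> Octo 0 ` Basis = {}"
    by auto
  ultimately show ?thesis
    by (simp add: Basis_octo_def card_Un_disjoint)
qed

subsection \<open>Real parts and imaginary units\<close>

definition re_part :: "'k::normed_division_algebra \<Rightarrow> real" where
  "re_part q = inner q 1"

definition imaginary :: "'k::normed_division_algebra set" where
  "imaginary = {p. re_part p = 0}"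

definition imag_units :: "'k::normed_division_algebra set" where
  "imag_units = {I. I * I = - 1}"

lemma re_part_quat: "re_part q = qr q"
  by (simp add: re_part_def inner_quat_def)

lemma re_part_octo: "re_part q = qr (ofst q)"
  by (simp add: re_part_def inner_octo_def inner_quat_def)

lemma nda_norm_one: "norm (1::'k::normed_division_algebra) = 1"
proof -
  obtain b :: 'k where "b \<in> Basis" using nonempty_Basis by blast
  then have "norm b = 1" by simp
  then show ?thesis using nda_norm_mult[of 1 b] by (simp add: nda_one_mult)
qed

lemma imag_units_iff: "I \<in> imag_units \<longleftrightarrow> I \<in> imaginary \<and> norm I = 1"
  for I :: "'k::normed_division_algebra"
proof -
  have one: "inner (1::'k) 1 = 1"
    using nda_norm_one[where 'k='k] by (simp add: norm_eq_1)
  have "- 1 * (I + 1) = - (I + 1)"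
    using nda_scaleR_mult[of "-1" 1 "I + 1"] by (simp add: nda_one_mult)
  then have "(I - 1) * (I + 1) = I * I - 1"
    using nda_add_mult[of I "- 1" "I + 1"] nda_mult_add[of I I 1] by (simp add: nda_mult_one)
  then have "(norm (I * I - 1))\<^sup>2 = (norm (I - 1))\<^sup>2 * (norm (I + 1))\<^sup>2"
    by (metis nda_norm_mult power_mult_distrib)
  then have *: "(norm (I * I - 1))\<^sup>2 = ((norm I)\<^sup>2 + 1)\<^sup>2 - 4 * (inner I 1)\<^sup>2"
    by (simp add: power2_norm_eq_inner inner_add_left inner_add_right inner_diff_left
        inner_diff_right one inner_commute[of 1 I]) (simp add: power2_eq_square algebra_simps)
  show ?thesis
  proof
    assume "I \<in> imag_units"
    then have sq: "I * I = - 1" by (simp add: imag_units_def)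
    then have "norm I * norm I = 1"
      using nda_norm_mult[of I I] by (simp add: nda_norm_one)
    then have n: "norm I = 1"
      using norm_ge_zero[of I] by (metis abs_of_nonneg real_sqrt_abs2 real_sqrt_one)
    have "I * I - 1 = - 2 *\<^sub>R 1"
      by (simp add: sq scaleR_2)
    then have "norm (I * I - 1) = 2"
      by (metis abs_neg_numeral mult.right_neutral nda_norm_one norm_scaleR)
    then have "inner I 1 = 0"
      using * by (simp add: n)
    with n show "I \<in> imaginary \<and> norm I = 1"
      by (simp add: imaginary_def re_part_def)
  next
    assume "I \<in> imaginary \<and> norm I = 1"
    then have n: "norm I = 1" and "inner I 1 = 0"
      by (auto simp: imaginary_def re_part_def)
    then have "inner (I * I - 1) (I * I - 1) = 4"
      using * by (simp add: power2_norm_eq_inner)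
    moreover have "inner (I * I) (I * I) = 1"
      using nda_norm_mult[of I I] n by (simp add: norm_eq_1)
    ultimately have "inner (I * I + 1) (I * I + 1) = 0"
      by (simp add: inner_add_left inner_add_right inner_diff_left inner_diff_right one
          inner_commute)
    then show "I \<in> imag_units"
      by (simp add: imag_units_def eq_neg_iff_add_eq_0)
  qed
qed

lemma imag_units_nonempty:
  "(imag_units :: quat set) \<noteq> {}" "(imag_units :: octo set) \<noteq> {}"
proof -
  have "Quat 0 1 0 0 \<in> imag_units" "Octo (Quat 0 1 0 0) 0 \<in> imag_units"
    by (simp_all add: imag_units_def quat_eq_iff octo_eq_iff)
  then show "(imag_units :: quat set) \<noteq> {}" "(imag_units :: octo set) \<noteq> {}"
    by blast+
qed

lemma ex_slice:
  fixes q :: "'k::normed_division_algebra"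
  assumes "(imag_units :: 'k set) \<noteq> {}"
  shows "\<exists>y. \<exists>I\<in>imag_units. q = re_part q *\<^sub>R 1 + y *\<^sub>R I"
proof -
  define p where "p = q - re_part q *\<^sub>R 1"
  have "inner (1::'k) 1 = 1"
    using nda_norm_one[where 'k='k] by (simp add: norm_eq_1)
  then have p: "inner p 1 = 0"
    by (simp add: p_def inner_diff_left re_part_def)
  have "\<exists>y. \<exists>I\<in>imag_units. p = y *\<^sub>R I"
  proof (cases "p = 0")
    case True
    then show ?thesis using assms by (intro exI[of _ 0]) auto
  next
    case False
    with p have "sgn p \<in> imag_units"
      by (simp add: imag_units_iff imaginary_def re_part_def sgn_div_norm)
    moreover have "p = norm p *\<^sub>R sgn p"
      using False by (simp add: sgn_div_norm)
    ultimately show ?thesis by blast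
  qed
  then show ?thesis by (auto simp: p_def algebra_simps)
qed

section \<open>The logarithm manifold, the exponential and the logarithm\<close>

text \<open>The map \<open>x + I y \<mapsto> F x y I\<close>.  The decomposition is unique only up to
  \<open>(y, I) \<mapsto> (- y, - I)\<close> if \<open>y \<noteq> 0\<close>, and up to an arbitrary change of \<open>I\<close> if \<open>y = 0\<close>;
  the lemma \<open>from_slices_eq\<close> is the resulting criterion of well-definedness.\<close>

definition from_slices ::
  "(real \<Rightarrow> real \<Rightarrow> 'k \<Rightarrow> 'b) \<Rightarrow> 'k::normed_division_algebra \<Rightarrow> 'b" where
  "from_slices F q =
    (THE w. \<exists>x y. \<exists>I\<in>imag_units. q = x *\<^sub>R 1 + y *\<^sub>R I \<and> w = F x y I)"

lemma slices_unique:
  fixes I J :: "'k::normed_division_algebra"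
  assumes "I \<in> imag_units" "J \<in> imag_units"
    and eq: "x *\<^sub>R 1 + y *\<^sub>R I = x' *\<^sub>R 1 + y' *\<^sub>R J"
  shows "x' = x \<and> (y = 0 \<and> y' = 0 \<or> y' = y \<and> J = I \<or> y' = - y \<and> J = - I)"
proof -
  have I: "inner I 1 = 0" "norm I = 1" and J: "inner J 1 = 0" "norm J = 1"
    using assms by (auto simp: imag_units_iff imaginary_def re_part_def)
  have one: "inner (1::'k) 1 = 1"
    using nda_norm_one[where 'k='k] by (simp add: norm_eq_1)
  have x: "x' = x"
    using arg_cong[OF eq, of "\<lambda>z. inner z 1"] by (simp add: inner_add_left I J one)
  with eq have yI: "y *\<^sub>R I = y' *\<^sub>R J" by simp
  then have "norm (y *\<^sub>R I) = norm (y' *\<^sub>R J)" by (rule arg_cong)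
  then have "\<bar>y\<bar> = \<bar>y'\<bar>" by (simp add: I J)
  then consider "y' = y" | "y' = - y" by linarith
  then show ?thesis
  proof cases
    case 1
    with yI x show ?thesis by auto
  next
    case 2
    with yI have "y *\<^sub>R (J + I) = 0" by (simp add: scaleR_add_right)
    with 2 x show ?thesis by (auto simp: eq_neg_iff_add_eq_0)
  qed
qed

lemma from_slices_eq:
  assumes "\<And>x y I. F x (- y) (- I) = F x y I" "\<And>x I J. F x 0 I = F x 0 J"
    and "I \<in> imag_units"
  shows "from_slices F (x *\<^sub>R 1 + y *\<^sub>R I) = F x y I"
  unfolding from_slices_def
proof (rule the_equality)
  show "\<exists>x' y'. \<exists>J\<in>imag_units. x *\<^sub>R 1 + y *\<^sub>R I = x' *\<^sub>R 1 + y' *\<^sub>R J \<and> F x y I = F x' y' J"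
    using assms(3) by blast
next
  fix w
  assume "\<exists>x' y'. \<exists>J\<in>imag_units. x *\<^sub>R 1 + y *\<^sub>R I = x' *\<^sub>R 1 + y' *\<^sub>R J \<and> w = F x' y' J"
  then obtain x' y' J where J: "J \<in> imag_units"
    and eq: "x *\<^sub>R 1 + y *\<^sub>R I = x' *\<^sub>R 1 + y' *\<^sub>R J" and w: "w = F x' y' J"
    by blast
  show "w = F x y I"
    using slices_unique[OF assms(3) J eq] assms(1)[of x y I] assms(2)[of x J I] w by auto
qed

definition log_param :: "'k::normed_division_algebra \<Rightarrow> 'k \<times> 'k" where
  "log_param =
    from_slices (\<lambda>x y I. ((sinh x * cos y) *\<^sub>R 1 + (sinh x * sin y) *\<^sub>R I, y *\<^sub>R I))"

definition log_manifold :: "('k::normed_division_algebra \<times> 'k) set" where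
  "log_manifold = log_param ` {q. re_part q > 0}"

definition E_exp :: "'k::normed_division_algebra \<Rightarrow> 'k \<times> 'k" where
  "E_exp = from_slices (\<lambda>x y I. ((exp x * cos y) *\<^sub>R 1 + (exp x * sin y) *\<^sub>R I, y *\<^sub>R I))"

definition E_log :: "'k::normed_division_algebra \<times> 'k \<Rightarrow> 'k" where
  "E_log = (\<lambda>(q, p). ln (norm q) *\<^sub>R 1 + p)"

lemma log_param_eq:
  "I \<in> imag_units \<Longrightarrow> log_param (x *\<^sub>R 1 + y *\<^sub>R I) =
    ((sinh x * cos y) *\<^sub>R 1 + (sinh x * sin y) *\<^sub>R I, y *\<^sub>R I)"
  unfolding log_param_def by (rule from_slices_eq) auto

lemma E_exp_eq:
  "I \<in> imag_units \<Longrightarrow> E_exp (x *\<^sub>R 1 + y *\<^sub>R I) =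
    ((exp x * cos y) *\<^sub>R 1 + (exp x * sin y) *\<^sub>R I, y *\<^sub>R I)"
  unfolding E_exp_def by (rule from_slices_eq) auto

lemma log_manifold_subset:
  assumes "(imag_units :: 'k::normed_division_algebra set) \<noteq> {}"
  shows "(log_manifold :: ('k \<times> 'k) set) \<subseteq> UNIV \<times> imaginary"
proof -
  have "snd (log_param q) \<in> imaginary" for q :: 'k
  proof -
    obtain y I where I: "I \<in> imag_units" and q: "q = re_part q *\<^sub>R 1 + y *\<^sub>R I"
      using ex_slice[OF assms] by blast
    have "snd (log_param q) = y *\<^sub>R I"
      by (subst q) (simp add: log_param_eq[OF I])
    with I show ?thesis
      by (simp add: imag_units_iff imaginary_def re_part_def)
  qed
  then show ?thesis unfolding log_manifold_def by (intro image_subsetI) (simp add: mem_Times_iff)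
qed

section \<open>Smooth maps and diffeomorphisms of embedded submanifolds\<close>

text \<open>\<open>C_k_on k f U\<close> is meaningful for open \<open>U\<close>: all iterated directional derivatives of \<open>f\<close> up to
  order \<open>k\<close> exist as Frechet derivatives and are continuous on \<open>U\<close>.\<close>

primrec C_k_on ::
  "nat \<Rightarrow> ('a::euclidean_space \<Rightarrow> 'b::euclidean_space) \<Rightarrow> 'a set \<Rightarrow> bool" where
  "C_k_on 0 f U \<longleftrightarrow> continuous_on U f"
| "C_k_on (Suc k) f U \<longleftrightarrow> (\<forall>x\<in>U. f differentiable at x) \<and>
     (\<forall>v. C_k_on k (\<lambda>x. frechet_derivative f (at x) v) U)"

text \<open>On an arbitrary subset of a Euclidean space, smoothness means that the map extends locally to
  smooth maps on open subsets of that space.  If \<open>S\<close> is an embedded submanifold, this is smoothness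
  with respect to the submanifold structure of \<open>S\<close>.\<close>

definition smooth_map ::
  "'a set \<Rightarrow> ('a::euclidean_space \<Rightarrow> 'b::euclidean_space) \<Rightarrow> bool" where
  "smooth_map S f \<longleftrightarrow>
    (\<forall>x\<in>S. \<exists>U g. open U \<and> x \<in> U \<and> (\<forall>k. C_k_on k g U) \<and> (\<forall>y\<in>S \<inter> U. g y = f y))"

definition smooth_bij ::
  "'a set \<Rightarrow> 'b set \<Rightarrow> ('a::euclidean_space \<Rightarrow> 'b::euclidean_space) \<Rightarrow> bool" where
  "smooth_bij S T f \<longleftrightarrow> bij_betw f S T \<and> smooth_map S f \<and> smooth_map T (inv_into S f)"

definition embedded_submanifold :: "nat \<Rightarrow> 'a::euclidean_space set \<Rightarrow> bool" where
  "embedded_submanifold d S \<longleftrightarrow>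
    (\<forall>p\<in>S. \<exists>U V W (\<phi> :: 'a \<Rightarrow> 'a). open U \<and> p \<in> U \<and> open V \<and> smooth_bij U V \<phi> \<and>
      subspace W \<and> dim W = d \<and> \<phi> ` (S \<inter> U) = V \<inter> W)"

text \<open>By \<open>log_manifold_subset\<close>, \<open>log_manifold\<close> is contained in \<open>UNIV \<times> imaginary\<close>, which is a linear subspace of the type
  of all pairs; being an embedded submanifold and being a smooth map have the same meaning
  relative to either of these two ambient spaces.\<close>

definition diffeomorphism ::
  "'a set \<Rightarrow> 'b set \<Rightarrow> ('a::euclidean_space \<Rightarrow> 'b::euclidean_space) \<Rightarrow> bool" where
  "diffeomorphism S T f \<longleftrightarrow>
    (\<exists>d. embedded_submanifold d S \<and> embedded_submanifold d T) \<and> smooth_bij S T f"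

end

theory Submission
  imports Defs
begin

text \<open>For imaginary \<open>p\<close> let \<open>u p = cos |p| + (sin |p| / |p|) p\<close> be the exponential of \<open>p\<close>.
  It is a smooth function of \<open>p\<close>, since \<open>cos |p|\<close> and \<open>sin |p| / |p|\<close> are entire power series in
  \<open>|p|\<^sup>2\<close>, and \<open>|u p| = 1\<close>.  Hence \<open>E (x + p) = (exp x * u p, p)\<close> is smooth with smooth left inverse
  \<open>L\<close>, and the logarithm manifold is the set of all \<open>(r * u p, p)\<close> with \<open>r > 0\<close>.  Although the
  multiplication need not be associative, \<open>(a * u p) * u (- p) = a\<close> holds; therefore
  \<open>(q, p) \<mapsto> (q * u (- Im p), p)\<close> is a diffeomorphism of the ambient space, and it straightens the
  logarithm manifold to a half-space of a linear subspace.\<close>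

section \<open>Calculus of \<open>C_k_on\<close>\<close>

text \<open>As U is open, the derivative at a point of U depends only on values taken in U. Hence
  the derivatives of f and g agree on U, and the induction passes to them.\<close>

lemma C_k_on_cong:
  assumes "open U" "\<And>x. x \<in> U \<Longrightarrow> f x = g x" "C_k_on k f U"
  shows "C_k_on k g U"
  using assms(2,3)
proof (induction k arbitrary: f g)
  case 0
  then show ?case by (simp add: continuous_on_eq)
next
  case (Suc k)
  have diff: "f differentiable at x" if "x \<in> U" for x
    using Suc.prems(2) that by simp
  have g': "(g has_derivative frechet_derivative f (at x)) (at x)" if "x \<in> U" for x
    using has_derivative_transform_within_open[OF _ \<open>open U\<close> that Suc.prems(1)]
      diff[OF that] by (simp add: frechet_derivative_works)
  have eq: "frechet_derivative f (at x) = frechet_derivative g (at x)" if "x \<in> U" for x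
    using g'[OF that] by (rule frechet_derivative_at)
  have "C_k_on k (\<lambda>x. frechet_derivative g (at x) v) U" for v
    by (rule Suc.IH[where f = "\<lambda>x. frechet_derivative f (at x) v"])
      (use eq Suc.prems(2) in simp_all)
  with g' show ?case by (auto simp: differentiable_def)
qed

text \<open>\<open>C_k_on\<close> refers to the chosen \<open>frechet_derivative\<close>; by
  uniqueness of derivatives any explicit family \<open>f'\<close> may take its place.\<close>

lemma C_k_on_SucI:
  assumes "open U" "\<And>x. x \<in> U \<Longrightarrow> (f has_derivative f' x) (at x)"
    and "\<And>v. C_k_on k (\<lambda>x. f' x v) U"
  shows "C_k_on (Suc k) f U"
proof -
  have "frechet_derivative f (at x) = f' x" if "x \<in> U" for x
    using assms(2)[OF that] by (rule frechet_derivative_at[symmetric])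
  then have "C_k_on k (\<lambda>x. frechet_derivative f (at x) v) U" for v
    by (intro C_k_on_cong[OF assms(1) _ assms(3)[of v]]) simp
  moreover have "f differentiable at x" if "x \<in> U" for x
    using assms(2)[OF that] by (auto simp: differentiable_def)
  ultimately show ?thesis by simp
qed

lemma C_k_on_SucE:
  assumes "C_k_on (Suc k) f U"
  obtains f' where "\<And>x. x \<in> U \<Longrightarrow> (f has_derivative f' x) (at x)"
    "\<And>v. C_k_on k (\<lambda>x. f' x v) U"
proof (rule that[of "\<lambda>x. frechet_derivative f (at x)"])
  show "(f has_derivative frechet_derivative f (at x)) (at x)" if "x \<in> U" for x
    using assms that unfolding frechet_derivative_works[symmetric] by simp
  show "C_k_on k (\<lambda>x. frechet_derivative f (at x) v) U" for v
    using assms by simp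
qed

text \<open>Continuity of f is not a clause at successor orders. It is recovered from
  differentiability at order 0, and the higher orders follow by passing to derivatives.\<close>

lemma C_k_on_Suc_imp:
  "C_k_on (Suc k) f U \<Longrightarrow> C_k_on k f U"
proof (induction k arbitrary: f)
  case 0
  then have "continuous (at x) f" if "x \<in> U" for x
    using that by (intro differentiable_imp_continuous_within) simp
  then show ?case
    by (simp add: continuous_at_imp_continuous_on)
qed auto

lemma C_k_on_imp_continuous_on: "C_k_on k f U \<Longrightarrow> continuous_on U f"
  by (induction k) (auto dest: C_k_on_Suc_imp simp del: C_k_on.simps(2))

lemma C_k_on_const: "open U \<Longrightarrow> C_k_on k (\<lambda>x. c) U"
proof (induction k arbitrary: c)
  case (Suc k)
  then show ?case
    by (intro C_k_on_SucI[where f' = "\<lambda>_ _. 0"]) auto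
qed auto

lemma C_k_on_id: "open U \<Longrightarrow> C_k_on k (\<lambda>x. x) U"
proof (induction k)
  case (Suc k)
  then show ?case
    by (intro C_k_on_SucI[where f' = "\<lambda>_ v. v"] C_k_on_const) auto
qed auto

lemma C_k_on_linear:
  assumes "bounded_linear h" "open U" "C_k_on k f U"
  shows "C_k_on k (\<lambda>x. h (f x)) U"
  using assms(3)
proof (induction k arbitrary: f)
  case 0
  then show ?case using assms(1) by (auto intro: bounded_linear.continuous_on)
next
  case (Suc k)
  obtain f' where "\<And>x. x \<in> U \<Longrightarrow> (f has_derivative f' x) (at x)"
    "\<And>v. C_k_on k (\<lambda>x. f' x v) U"
    using C_k_on_SucE[OF Suc.prems] by blast
  then show ?case
    using assms Suc.IH
    by (intro C_k_on_SucI[where f' = "\<lambda>x v. h (f' x v)"])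
      (auto intro: bounded_linear.has_derivative)
qed

lemma C_k_on_add:
  assumes "open U" "C_k_on k f U" "C_k_on k g U"
  shows "C_k_on k (\<lambda>x. f x + g x) U"
  using assms(2,3)
proof (induction k arbitrary: f g)
  case 0
  then show ?case by (auto intro: continuous_on_add)
next
  case (Suc k)
  obtain f' where f': "\<And>x. x \<in> U \<Longrightarrow> (f has_derivative f' x) (at x)"
    "\<And>v. C_k_on k (\<lambda>x. f' x v) U"
    using C_k_on_SucE[OF Suc.prems(1)] by blast
  obtain g' where g': "\<And>x. x \<in> U \<Longrightarrow> (g has_derivative g' x) (at x)"
    "\<And>v. C_k_on k (\<lambda>x. g' x v) U"
    using C_k_on_SucE[OF Suc.prems(2)] by blast
  show ?case
    using f' g' assms(1) Suc.IH
    by (intro C_k_on_SucI[where f' = "\<lambda>x v. f' x v + g' x v"])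
      (auto intro: has_derivative_add)
qed

lemma C_k_on_sum:
  assumes "open U" "finite A" "\<And>a. a \<in> A \<Longrightarrow> C_k_on k (f a) U"
  shows "C_k_on k (\<lambda>x. \<Sum>a\<in>A. f a x) U"
  using assms(2,3) by (induction A rule: finite_induct) (auto intro: C_k_on_const C_k_on_add assms(1))

lemma C_k_on_bilinear:
  assumes "bounded_bilinear h" "open U" "C_k_on k f U" "C_k_on k g U"
  shows "C_k_on k (\<lambda>x. h (f x) (g x)) U"
  using assms(3,4)
proof (induction k arbitrary: f g)
  case 0
  then show ?case using assms(1) by (auto intro: bounded_bilinear.continuous_on)
next
  case (Suc k)
  obtain f' where f': "\<And>x. x \<in> U \<Longrightarrow> (f has_derivative f' x) (at x)"
    "\<And>v. C_k_on k (\<lambda>x. f' x v) U"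
    using C_k_on_SucE[OF Suc.prems(1)] by blast
  obtain g' where g': "\<And>x. x \<in> U \<Longrightarrow> (g has_derivative g' x) (at x)"
    "\<And>v. C_k_on k (\<lambda>x. g' x v) U"
    using C_k_on_SucE[OF Suc.prems(2)] by blast
  show ?case
  \<comment> \<open>Leibniz rule: each summand is again \<open>h\<close> of two functions, so the
    induction hypothesis applies once \<open>C_k_on_Suc_imp\<close> has lowered the undifferentiated
    factor to order k.\<close>
  proof (intro C_k_on_SucI[where f' = "\<lambda>x v. h (f x) (g' x v) + h (f' x v) (g x)"] assms(2))
    show "((\<lambda>x. h (f x) (g x)) has_derivative (\<lambda>v. h (f x) (g' x v) + h (f' x v) (g x))) (at x)"
      if "x \<in> U" for x
      using bounded_bilinear.FDERIV[OF assms(1) f'(1)[OF that] g'(1)[OF that]] .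
    show "C_k_on k (\<lambda>x. h (f x) (g' x v) + h (f' x v) (g x)) U" for v
      by (intro C_k_on_add assms(2) Suc.IH f' g' Suc.prems[THEN C_k_on_Suc_imp])
  qed
qed

lemma C_k_on_compose:
  assumes "open U" "f ` U \<subseteq> V" "C_k_on k f U" "C_k_on k g V"
  shows "C_k_on k (\<lambda>x. g (f x)) U"
  using assms(3,4)
proof (induction k arbitrary: g)
  case 0
  then show ?case using assms(2) by (auto intro: continuous_on_compose2)
next
  case (Suc k)
  obtain f' where f': "\<And>x. x \<in> U \<Longrightarrow> (f has_derivative f' x) (at x)"
    "\<And>v. C_k_on k (\<lambda>x. f' x v) U"
    using C_k_on_SucE[OF Suc.prems(1)] by blast
  obtain g' where g': "\<And>x. x \<in> V \<Longrightarrow> (g has_derivative g' x) (at x)"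
    "\<And>v. C_k_on k (\<lambda>x. g' x v) V"
    using C_k_on_SucE[OF Suc.prems(2)] by blast
  \<comment> \<open>In the chain rule \<open>g' (f x) (f' x v)\<close> the direction varies with x,
    whereas the regularity of \<open>g'\<close> is known only in fixed directions; hence the
    expansion of \<open>f' x v\<close> in the basis.\<close>
  show ?case
  proof (intro C_k_on_SucI[where f' = "\<lambda>x v. \<Sum>b\<in>Basis. inner (f' x v) b *\<^sub>R g' (f x) b"]
      assms(1))
    fix x assume x: "x \<in> U"
    then have g'x: "(g has_derivative g' (f x)) (at (f x))"
      using g'(1) assms(2) by blast
    then interpret bounded_linear "g' (f x)" by (rule has_derivative_bounded_linear)
    have "(\<Sum>b\<in>Basis. inner w b *\<^sub>R g' (f x) b) = g' (f x) w" for w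
      using sum[of "\<lambda>b. inner w b *\<^sub>R b" Basis] unfolding euclidean_representation
      by (simp only: scaleR)
    then show "((\<lambda>x. g (f x)) has_derivative
        (\<lambda>v. \<Sum>b\<in>Basis. inner (f' x v) b *\<^sub>R g' (f x) b)) (at x)"
      using has_derivative_compose[OF f'(1)[OF x] g'x] by (simp only:)
  next
    show "C_k_on k (\<lambda>x. \<Sum>b\<in>Basis. inner (f' x v) b *\<^sub>R g' (f x) b) U" for v
      by (intro C_k_on_sum assms(1) finite_Basis C_k_on_bilinear[OF bounded_bilinear_scaleR]
          C_k_on_linear[OF bounded_linear_inner_left] f' g' Suc.IH
          Suc.prems(1)[THEN C_k_on_Suc_imp])
  qed
qed

lemma C_k_on_Pair:
  assumes "open U" "C_k_on k f U" "C_k_on k g U"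
  shows "C_k_on k (\<lambda>x. (f x, g x)) U"
proof -
  have "C_k_on k (\<lambda>x. (f x, 0) + (0, g x)) U"
    by (intro C_k_on_add assms C_k_on_linear[where h = "\<lambda>x. (x, 0)"]
        C_k_on_linear[where h = "\<lambda>x. (0, x)"] bounded_linear_intros)
  then show ?thesis by simp
qed

section \<open>Smoothness of real functions of one variable\<close>

lemma C_k_on_real_SucI:
  fixes f :: "real \<Rightarrow> real"
  assumes "open U" "\<And>x. x \<in> U \<Longrightarrow> (f has_field_derivative f' x) (at x)" "C_k_on k f' U"
  shows "C_k_on (Suc k) f U"
  using assms
  by (intro C_k_on_SucI[where f' = "\<lambda>x v. f' x * v"] C_k_on_bilinear[OF bounded_bilinear_mult]
      C_k_on_const) (auto simp: has_field_derivative_def)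

lemma C_k_on_exp: "C_k_on k (exp :: real \<Rightarrow> real) UNIV"
proof (induction k)
  case (Suc k)
  then show ?case by (intro C_k_on_real_SucI[where f' = exp]) (auto intro: DERIV_exp)
qed (auto intro: continuous_on_exp continuous_on_id)

lemma C_k_on_inverse: "C_k_on k (inverse :: real \<Rightarrow> real) {0<..}"
proof (induction k)
  case 0
  then show ?case by (auto intro!: continuous_on_inverse continuous_on_id)
next
  case (Suc k)
  show ?case
  proof (rule C_k_on_real_SucI[where f' = "\<lambda>x. - (inverse x * inverse x)"])
    show "(inverse has_field_derivative - (inverse x * inverse x)) (at x)" if "x \<in> {0<..}"
      for x :: real
      using DERIV_inverse[of x UNIV] that by simp
    show "C_k_on k (\<lambda>x::real. - (inverse x * inverse x)) {0<..}"
      by (intro C_k_on_linear[OF bounded_linear_minus[OF bounded_linear_ident]]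
          C_k_on_bilinear[OF bounded_bilinear_mult] Suc.IH) auto
  qed simp
qed

lemma C_k_on_ln: "C_k_on k (ln :: real \<Rightarrow> real) {0<..}"
proof (cases k)
  case 0
  then show ?thesis by (auto intro!: continuous_on_ln continuous_on_id)
next
  case (Suc l)
  show ?thesis
    unfolding Suc
    by (rule C_k_on_real_SucI[where f' = inverse])
      (simp_all add: C_k_on_inverse DERIV_ln)
qed

text \<open>Termwise differentiation gives the coefficients \<open>diffs c\<close>, whose series
  again converges everywhere; so the induction runs over all c at once.\<close>

lemma C_k_on_powser:
  fixes c :: "nat \<Rightarrow> real"
  assumes "\<And>x. summable (\<lambda>n. c n * x ^ n)"
  shows "C_k_on k (\<lambda>x. \<Sum>n. c n * x ^ n) UNIV"
  using assms
proof (induction k arbitrary: c)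
  case 0
  then have "((\<lambda>x. \<Sum>n. c n * x ^ n) has_field_derivative (\<Sum>n. diffs c n * x ^ n)) (at x)" for x
    by (rule termdiffs_strong_converges_everywhere)
  then have "isCont (\<lambda>x. \<Sum>n. c n * x ^ n) x" for x
    by (rule DERIV_isCont)
  then show ?case
    by (simp add: continuous_at_imp_continuous_on)
next
  case (Suc k)
  show ?case
  proof (rule C_k_on_real_SucI)
    show "((\<lambda>x. \<Sum>n. c n * x ^ n) has_field_derivative (\<Sum>n. diffs c n * x ^ n)) (at x)" for x
      using Suc.prems by (rule termdiffs_strong_converges_everywhere)
    show "C_k_on k (\<lambda>x. \<Sum>n. diffs c n * x ^ n) UNIV"
      by (rule Suc.IH) (rule termdiff_converges_all[OF Suc.prems])
  qed simp
qed

section \<open>Criteria for smooth maps and smooth bijections\<close>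

lemma smooth_mapI:
  assumes "open U" "S \<subseteq> U" "\<And>k. C_k_on k g U" "\<And>x. x \<in> S \<Longrightarrow> g x = f x"
  shows "smooth_map S f"
  unfolding smooth_map_def using assms by blast

text \<open>Here \<open>f'\<close> is not a derivative but a smooth extension of f to the open set
  U. The inverse g is given smooth on the open set V and serves as the extension of
  \<open>inv_into S f\<close>.\<close>

lemma smooth_bijI:
  assumes "open U" "S \<subseteq> U" "\<And>k. C_k_on k f' U" "\<And>x. x \<in> S \<Longrightarrow> f' x = f x"
    and "open V" "T \<subseteq> V" "\<And>k. C_k_on k g V"
    and "f \<in> S \<rightarrow> T" "g \<in> T \<rightarrow> S" "\<And>x. x \<in> S \<Longrightarrow> g (f x) = x" "\<And>y. y \<in> T \<Longrightarrow> f (g y) = y"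
  shows "smooth_bij S T f"
proof -
  have bij: "bij_betw f S T"
    using assms(8-11) by (intro bij_betw_byWitness[where f' = g]) auto
  have "g y = inv_into S f y" if "y \<in> T" for y
    using inv_into_f_f[OF bij_betw_imp_inj_on[OF bij] funcset_mem[OF assms(9) that]] assms(11)[OF that]
    by simp
  then have "smooth_map T (inv_into S f)"
    using assms(5-7) by (rule smooth_mapI[rotated 3])
  moreover have "smooth_map S f"
    using assms(1-4) by (rule smooth_mapI)
  ultimately show ?thesis
    using bij unfolding smooth_bij_def by simp
qed

lemma embedded_submanifold_UNIV:
  "embedded_submanifold DIM('a) (UNIV :: 'a::euclidean_space set)"
proof -
  have "smooth_bij (UNIV :: 'a set) UNIV (\<lambda>x. x)"
    by (rule smooth_bijI[where U = UNIV and V = UNIV and f' = "\<lambda>x. x" and g = "\<lambda>x. x"])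
      (simp_all add: C_k_on_id)
  then show ?thesis
    unfolding embedded_submanifold_def
    by (intro ballI exI[of _ UNIV] exI[of _ "\<lambda>x. x"]) simp
qed

section \<open>The exponential of imaginary elements\<close>

text \<open>The entire function equal to cos (sqrt s) for s \<ge> 0. The series avoids the square
  root, which is not differentiable at 0.\<close>

definition cos_sqrt :: "real \<Rightarrow> real" where
  "cos_sqrt s = (\<Sum>n. (-1) ^ n / fact (2 * n) * s ^ n)"

text \<open>The entire function equal to sin (sqrt s) / sqrt s for s > 0 and to 1 at 0.\<close>

definition sinc_sqrt :: "real \<Rightarrow> real" where
  "sinc_sqrt s = (\<Sum>n. (-1) ^ n / fact (2 * n + 1) * s ^ n)"

text \<open>Comparison with the exponential series at \<open>\<bar>x\<bar>\<close>.\<close>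

lemma summable_powser_fact:
  fixes c :: "nat \<Rightarrow> real"
  assumes "\<And>n. \<bar>c n\<bar> \<le> 1 / fact n"
  shows "summable (\<lambda>n. c n * x ^ n)"
proof (rule summable_comparison_test')
  show "summable (\<lambda>n. inverse (fact n) * \<bar>x\<bar> ^ n)"
    by (rule summable_exp)
  show "norm (c n * x ^ n) \<le> inverse (fact n) * \<bar>x\<bar> ^ n" if "n \<ge> 0" for n
    using mult_right_mono[OF assms[of n], of "\<bar>x\<bar> ^ n"]
    by (simp add: abs_mult power_abs field_simps)
qed

lemma summable_cos_sqrt: "summable (\<lambda>n. (-1) ^ n / fact (2 * n) * (s::real) ^ n)"
  by (rule summable_powser_fact) (simp add: abs_divide power_abs frac_le fact_mono)

lemma summable_sinc_sqrt: "summable (\<lambda>n. (-1) ^ n / fact (2 * n + 1) * (s::real) ^ n)"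
  by (rule summable_powser_fact)
    (simp add: abs_divide power_abs frac_le fact_mono del: fact_Suc)

lemma cos_sqrt_square: "cos_sqrt (y\<^sup>2) = cos y"
  unfolding cos_sqrt_def using sums_unique[OF cos_paired[of y]] by (simp add: power_mult)

text \<open>The product form avoids division by y and so includes y = 0.\<close>

lemma sinc_sqrt_square: "sinc_sqrt (y\<^sup>2) * y = sin y"
proof -
  have "sinc_sqrt (y\<^sup>2) * y = (\<Sum>n. (-1) ^ n / fact (2 * n + 1) * (y\<^sup>2) ^ n * y)"
    unfolding sinc_sqrt_def using summable_sinc_sqrt by (rule suminf_mult2)
  also have "\<dots> = sin y"
    using sums_unique[OF sin_paired[of y]]
    by (simp add: power_mult mult.assoc mult.commute[of y] del: fact_Suc)
  finally show ?thesis .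
qed

lemma C_k_on_cos_sqrt: "C_k_on k cos_sqrt UNIV"
  using C_k_on_powser[OF summable_cos_sqrt] by (simp add: cos_sqrt_def[abs_def])

lemma C_k_on_sinc_sqrt: "C_k_on k sinc_sqrt UNIV"
  using C_k_on_powser[OF summable_sinc_sqrt] by (simp add: sinc_sqrt_def[abs_def])

section \<open>The exponential of imaginary elements and the splitting into real and imaginary
  parts\<close>

definition unit_exp :: "'k::normed_division_algebra \<Rightarrow> 'k" where
  "unit_exp p = cos_sqrt (inner p p) *\<^sub>R 1 + sinc_sqrt (inner p p) *\<^sub>R p"

definition im_part :: "'k::normed_division_algebra \<Rightarrow> 'k" where
  "im_part q = q - re_part q *\<^sub>R 1"

lemma nda_inner_one: "inner (1::'k::normed_division_algebra) 1 = 1"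
  using nda_norm_one[where 'k='k] by (simp add: norm_eq_1)

lemma re_part_one: "re_part (1::'k::normed_division_algebra) = 1"
  by (simp add: re_part_def nda_inner_one)

lemma re_part_add: "re_part (a + b) = re_part a + re_part b"
  by (simp add: re_part_def inner_add_left)

lemma re_part_scaleR: "re_part (r *\<^sub>R a) = r * re_part a"
  by (simp add: re_part_def)

lemma im_part_imaginary: "im_part q \<in> imaginary"
  by (simp add: im_part_def imaginary_def re_part_def inner_diff_left nda_inner_one)

lemma im_part_of_imaginary: "p \<in> imaginary \<Longrightarrow> im_part p = p"
  by (simp add: im_part_def imaginary_def)

lemma re_im_decomp: "re_part q *\<^sub>R 1 + im_part q = q"
  by (simp add: im_part_def)

lemma re_part_decomp: "p \<in> imaginary \<Longrightarrow> re_part (x *\<^sub>R 1 + p) = x"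
  by (simp add: re_part_add re_part_scaleR re_part_one imaginary_def)

lemma im_part_decomp: "p \<in> imaginary \<Longrightarrow> im_part (x *\<^sub>R 1 + p) = p"
  by (simp add: im_part_def re_part_decomp)

lemma bounded_linear_re_part: "bounded_linear re_part"
  unfolding re_part_def[abs_def] by (rule bounded_linear_inner_left)

lemma bounded_linear_im_part: "bounded_linear im_part"
  unfolding im_part_def[abs_def] re_part_def by (intro bounded_linear_intros)

text \<open>Since |y I|^2 = y^2, the series in the squared norm can be evaluated for y of either
  sign.\<close>

lemma unit_exp_slice:
  assumes "I \<in> imag_units"
  shows "unit_exp (y *\<^sub>R I) = cos y *\<^sub>R 1 + sin y *\<^sub>R I"
proof -
  have "inner (y *\<^sub>R I) (y *\<^sub>R I) = y\<^sup>2"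
    using assms by (simp add: imag_units_iff norm_eq_1 power2_eq_square)
  then show ?thesis
    by (simp add: unit_exp_def cos_sqrt_square sinc_sqrt_square)
qed

text \<open>p is orthogonal to 1, so the cross terms vanish and cos^2 + sin^2 of |p|
  remains.\<close>

lemma norm_unit_exp:
  assumes "p \<in> imaginary"
  shows "norm (unit_exp p) = 1"
proof -
  have p: "inner p 1 = 0" "inner 1 p = 0"
    using assms by (auto simp: imaginary_def re_part_def inner_commute)
  have s: "inner p p = (norm p)\<^sup>2" by (simp add: power2_norm_eq_inner)
  have "inner (unit_exp p) (unit_exp p) =
      (cos_sqrt (inner p p))\<^sup>2 + (sinc_sqrt (inner p p))\<^sup>2 * inner p p"
    by (simp add: unit_exp_def inner_add_left inner_add_right p nda_inner_one power2_eq_square)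
  also have "\<dots> = (cos (norm p))\<^sup>2 + (sinc_sqrt ((norm p)\<^sup>2) * norm p)\<^sup>2"
    by (simp add: s cos_sqrt_square power_mult_distrib)
  also have "\<dots> = 1" by (simp add: sinc_sqrt_square)
  finally show ?thesis by (simp add: norm_eq_1)
qed

lemma C_k_on_unit_exp:
  assumes "open U" "C_k_on k f U"
  shows "C_k_on k (\<lambda>x. unit_exp (f x)) U"
  unfolding unit_exp_def
  by (intro C_k_on_add C_k_on_bilinear[OF bounded_bilinear_scaleR]
      C_k_on_compose[OF _ _ _ C_k_on_cos_sqrt] C_k_on_compose[OF _ _ _ C_k_on_sinc_sqrt]
      C_k_on_bilinear[OF bounded_bilinear_inner] C_k_on_const assms) auto

section \<open>Cancellation without associativity\<close>

lemma bounded_bilinear_nda_mult: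
  "bounded_bilinear ((*) :: 'k \<Rightarrow> 'k \<Rightarrow> 'k::normed_division_algebra)"
  by (rule bounded_bilinear.intro)
    (auto simp: nda_add_mult nda_mult_add nda_scaleR_mult nda_mult_scaleR nda_norm_mult
      intro!: exI[of _ 1])

text \<open>Polarisation of the multiplicative norm: expand |(a + c) b|^2.\<close>

lemma nda_inner_mult_right:
  fixes a b c :: "'k::normed_division_algebra"
  shows "inner (a * b) (c * b) = inner a c * inner b b"
proof -
  have sq: "inner (x * b) (x * b) = inner x x * inner b b" for x
    by (simp add: nda_norm_mult power_mult_distrib flip: power2_norm_eq_inner)
  have "inner (a * b) (a * b) + 2 * inner (a * b) (c * b) + inner (c * b) (c * b) =
      (inner a a + 2 * inner a c + inner c c) * inner b b"
    using sq[of "a + c"] inner_commute[of "c * b" "a * b"] inner_commute[of c a]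
    by (simp only: nda_add_mult inner_add_left inner_add_right mult_2 add_ac)
  then show ?thesis
    unfolding sq by (simp add: distrib_right)
qed

text \<open>Linearisation: put b + 1 for b in \<open>nda_inner_mult_right\<close> and compare the
  terms of degree one in b.\<close>

lemma nda_inner_mult_swap:
  fixes a b c :: "'k::normed_division_algebra"
  shows "inner (a * b) c + inner a (c * b) = 2 * inner a c * inner b 1"
proof -
  have "inner (a * b) (c * b) + inner (a * b) c + (inner a (c * b) + inner a c) =
      inner a c * (inner b b + 2 * inner b 1 + 1)"
    using nda_inner_mult_right[of a "b + 1" c] inner_commute[of 1 b]
    by (simp add: nda_mult_add nda_mult_one inner_add_left inner_add_right nda_inner_one
        add_ac)
  then show ?thesis
    unfolding nda_inner_mult_right by (simp add: distrib_left)
qed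

text \<open>Right multiplication by the conjugate \<open>2 Re b - b\<close> is adjoint to right multiplication
  by \<open>b\<close>, which replaces associativity.\<close>

lemma nda_mult_conj_cancel:
  fixes a b :: "'k::normed_division_algebra"
  shows "(a * b) * ((2 * re_part b) *\<^sub>R 1 - b) = inner b b *\<^sub>R a"
proof -
  interpret bounded_bilinear "(*) :: 'k \<Rightarrow> 'k \<Rightarrow> 'k" by (rule bounded_bilinear_nda_mult)
  \<comment> \<open>Tested against c, the swap identity at \<open>a * b\<close> turns the left side
    into \<open>inner (a * b) (c * b)\<close>.\<close>
  have "inner ((a * b) * ((2 * re_part b) *\<^sub>R 1 - b)) c = inner (inner b b *\<^sub>R a) c" for c
    using nda_inner_mult_swap[of "a * b" b c] nda_inner_mult_right[of a b c]
    by (simp add: diff_right scaleR_right nda_mult_one re_part_def inner_diff_left mult_ac)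
  then show ?thesis by (metis vector_eq_rdot)
qed

text \<open>The real term of \<open>unit_exp\<close> is even and the imaginary term odd in p, so
  \<open>unit_exp (- p)\<close> is the conjugate of \<open>unit_exp p\<close>, which has norm
  1.\<close>

lemma unit_exp_cancel:
  assumes "p \<in> imaginary"
  shows "(a * unit_exp p) * unit_exp (- p) = a"
proof -
  have "re_part (unit_exp p) = cos_sqrt (inner p p)"
    using assms by (simp add: unit_exp_def re_part_add re_part_scaleR re_part_one imaginary_def)
  then have "(2 * re_part (unit_exp p)) *\<^sub>R 1 - unit_exp p = unit_exp (- p)"
    by (simp add: unit_exp_def algebra_simps flip: scaleR_2)
  moreover have "inner (unit_exp p) (unit_exp p) = 1"
    using norm_unit_exp[OF assms] by (simp add: norm_eq_1)
  ultimately show ?thesis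
    using nda_mult_conj_cancel[of a "unit_exp p"] by simp
qed

lemma unit_exp_cancel':
  assumes "p \<in> imaginary"
  shows "(a * unit_exp (- p)) * unit_exp p = a"
  using unit_exp_cancel[of "- p" a] assms by (simp add: imaginary_def re_part_def)

section \<open>The logarithm manifold\<close>

text \<open>Trades the description over slices for a formula in real and imaginary parts.
  Nonemptiness of \<open>imag_units\<close> provides a slice through q.\<close>

lemma log_param_conv:
  fixes q :: "'k::normed_division_algebra"
  assumes "(imag_units :: 'k set) \<noteq> {}"
  shows "log_param q = (sinh (re_part q) *\<^sub>R unit_exp (im_part q), im_part q)"
proof -
  obtain y I where I: "I \<in> imag_units" and q: "q = re_part q *\<^sub>R 1 + y *\<^sub>R I"
    using ex_slice[OF assms] by blast
  then have im: "im_part q = y *\<^sub>R I"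
    by (simp add: im_part_def algebra_simps)
  show ?thesis
    using log_param_eq[OF I, of "re_part q" y] q
    by (simp add: im unit_exp_slice[OF I] scaleR_add_right)
qed

lemma E_exp_conv:
  fixes q :: "'k::normed_division_algebra"
  assumes "(imag_units :: 'k set) \<noteq> {}"
  shows "E_exp q = (exp (re_part q) *\<^sub>R unit_exp (im_part q), im_part q)"
proof -
  obtain y I where I: "I \<in> imag_units" and q: "q = re_part q *\<^sub>R 1 + y *\<^sub>R I"
    using ex_slice[OF assms] by blast
  then have im: "im_part q = y *\<^sub>R I"
    by (simp add: im_part_def algebra_simps)
  show ?thesis
    using E_exp_eq[OF I, of "re_part q" y] q
    by (simp add: im unit_exp_slice[OF I] scaleR_add_right)
qed

text \<open>\<open>sinh\<close> maps the positive reals onto themselves, so the radial factor is an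
  arbitrary r > 0. As \<open>exp\<close> is positive too, \<open>E_exp\<close> lands in the same
  set.\<close>

lemma log_manifold_conv:
  assumes "(imag_units :: 'k::normed_division_algebra set) \<noteq> {}"
  shows "(log_manifold :: ('k \<times> 'k) set) = {(r *\<^sub>R unit_exp p, p) | r p. r > 0 \<and> p \<in> imaginary}"
proof (intro equalityI subsetI)
  fix z :: "'k \<times> 'k"
  assume "z \<in> log_manifold"
  then obtain q where "re_part q > 0" "z = log_param q"
    by (auto simp: log_manifold_def)
  then show "z \<in> {(r *\<^sub>R unit_exp p, p) | r p. r > 0 \<and> p \<in> imaginary}"
    using im_part_imaginary[of q] by (auto simp: log_param_conv[OF assms])
next
  fix z :: "'k \<times> 'k"
  assume "z \<in> {(r *\<^sub>R unit_exp p, p) | r p. r > 0 \<and> p \<in> imaginary}"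
  then obtain r p where z: "z = (r *\<^sub>R unit_exp p, p)" "r > 0" "p \<in> imaginary"
    by blast
  define q where "q = arsinh r *\<^sub>R 1 + p"
  have "log_param q = z" "re_part q = arsinh r"
    using z by (simp_all add: q_def log_param_conv[OF assms] re_part_decomp im_part_decomp)
  with z(2) show "z \<in> log_manifold"
    unfolding log_manifold_def by (intro image_eqI[of _ _ q]) simp_all
qed

section \<open>The exponential and the logarithm as mutually inverse smooth maps\<close>

lemma E_exp_in_log_manifold:
  fixes q :: "'k::normed_division_algebra"
  assumes "(imag_units :: 'k set) \<noteq> {}"
  shows "E_exp q \<in> log_manifold"
  using im_part_imaginary[of q] exp_gt_zero[of "re_part q"]
  unfolding E_exp_conv[OF assms] log_manifold_conv[OF assms] by blast

lemma E_log_unit_exp: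
  assumes "p \<in> imaginary" "r > 0"
  shows "E_log (r *\<^sub>R unit_exp p, p) = ln r *\<^sub>R 1 + p"
  using assms by (simp add: E_log_def norm_unit_exp)

lemma E_log_E_exp:
  fixes q :: "'k::normed_division_algebra"
  assumes "(imag_units :: 'k set) \<noteq> {}"
  shows "E_log (E_exp q) = q"
  by (simp add: E_exp_conv[OF assms] E_log_unit_exp[OF im_part_imaginary] re_im_decomp)

lemma E_exp_E_log:
  fixes z :: "'k \<times> 'k::normed_division_algebra"
  assumes "(imag_units :: 'k set) \<noteq> {}" "z \<in> log_manifold"
  shows "E_exp (E_log z) = z"
  using assms(2)
  by (auto simp: log_manifold_conv[OF assms(1)] E_log_unit_exp E_exp_conv[OF assms(1)]
      re_part_decomp im_part_decomp)

text \<open>Writing ln |q| as ln (|q|^2) / 2 makes it a composition of \<open>ln\<close> with a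
  bilinear expression, smooth for q \<noteq> 0. The manifold lies in that open set because |r u p| =
  r > 0.\<close>

lemma smooth_bij_E_log:
  assumes "(imag_units :: 'k::normed_division_algebra set) \<noteq> {}"
  shows "smooth_bij log_manifold (UNIV :: 'k set) E_log"
proof (rule smooth_bijI[where U = "{z. fst z \<noteq> 0}" and V = UNIV and g = E_exp
      and f' = "\<lambda>z. (ln (inner (fst z) (fst z)) / 2) *\<^sub>R 1 + snd z"])
  show op: "open {z :: 'k \<times> 'k. fst z \<noteq> 0}"
    by (intro open_Collect_neq continuous_intros)
  show "log_manifold \<subseteq> {z :: 'k \<times> 'k. fst z \<noteq> 0}"
    using norm_unit_exp by (fastforce simp: log_manifold_conv[OF assms])
  show "C_k_on k (\<lambda>z. (ln (inner (fst z) (fst z)) / 2) *\<^sub>R 1 + snd z) {z :: 'k \<times> 'k. fst z \<noteq> 0}"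
    for k
    by (intro C_k_on_add C_k_on_linear[where h = "\<lambda>x. (x / 2) *\<^sub>R 1"]
        C_k_on_linear[OF bounded_linear_fst] C_k_on_linear[OF bounded_linear_snd]
        C_k_on_compose[OF _ _ _ C_k_on_ln] C_k_on_bilinear[OF bounded_bilinear_inner]
        C_k_on_id bounded_linear_intros bounded_linear_divide op)
      auto
  \<comment> \<open>This also covers q = 0, since \<open>ln 0 = 0\<close>.\<close>
  show "(ln (inner (fst z) (fst z)) / 2) *\<^sub>R 1 + snd z = E_log z" for z :: "'k \<times> 'k"
    by (cases z) (simp add: E_log_def norm_eq_sqrt_inner ln_sqrt)
  have "C_k_on k (\<lambda>q::'k. (exp (re_part q) *\<^sub>R unit_exp (im_part q), im_part q)) UNIV" for k
    by (intro C_k_on_Pair C_k_on_bilinear[OF bounded_bilinear_scaleR]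
        C_k_on_compose[OF _ _ _ C_k_on_exp] C_k_on_unit_exp
        C_k_on_linear[OF bounded_linear_re_part] C_k_on_linear[OF bounded_linear_im_part]
        C_k_on_id) auto
  then show "C_k_on k (E_exp :: 'k \<Rightarrow> 'k \<times> 'k) UNIV" for k
    by (rule C_k_on_cong[rotated 2]) (auto simp: E_exp_conv[OF assms])
qed (auto simp: assms E_exp_in_log_manifold E_log_E_exp E_exp_E_log)

section \<open>Straightening the logarithm manifold by one global chart\<close>

lemma embedded_submanifold_log_manifold:
  assumes "(imag_units :: 'k::normed_division_algebra set) \<noteq> {}"
  shows "embedded_submanifold DIM('k) (log_manifold :: ('k \<times> 'k) set)"
proof -
  \<comment> \<open>Taking \<open>im_part\<close> of the second component makes the cancellation
    laws available at every point, so that the map is invertible on the whole ambient space.\<close>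
  define \<phi> :: "'k \<times> 'k \<Rightarrow> 'k \<times> 'k" where
    "\<phi> = (\<lambda>z. (fst z * unit_exp (- im_part (snd z)), snd z))"
  define \<psi> :: "'k \<times> 'k \<Rightarrow> 'k \<times> 'k" where
    "\<psi> = (\<lambda>z. (fst z * unit_exp (im_part (snd z)), snd z))"
  define U :: "('k \<times> 'k) set" where "U = {z. re_part (fst (\<phi> z)) > 0}"
  define V :: "('k \<times> 'k) set" where "V = {z. re_part (fst z) > 0}"
  \<comment> \<open>As the image of an injective linear map on the algebra, W is a subspace of
    dimension \<open>DIM('k)\<close>.\<close>
  define W :: "('k \<times> 'k) set" where "W = range (\<lambda>q. (re_part q *\<^sub>R 1, im_part q))"
  have \<psi>\<phi>: "\<psi> (\<phi> z) = z" and \<phi>\<psi>: "\<phi> (\<psi> z) = z" for z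
    by (simp_all add: \<phi>_def \<psi>_def unit_exp_cancel unit_exp_cancel' im_part_imaginary)
  have C\<phi>: "C_k_on k \<phi> UNIV" for k
    unfolding \<phi>_def
    by (intro C_k_on_Pair C_k_on_bilinear[OF bounded_bilinear_nda_mult] C_k_on_unit_exp
        C_k_on_linear[OF bounded_linear_minus[OF bounded_linear_im_part]]
        C_k_on_linear[OF bounded_linear_fst] C_k_on_linear[OF bounded_linear_snd] C_k_on_id
        open_UNIV)
  have C\<psi>: "C_k_on k \<psi> UNIV" for k
    unfolding \<psi>_def
    by (intro C_k_on_Pair C_k_on_bilinear[OF bounded_bilinear_nda_mult] C_k_on_unit_exp
        C_k_on_linear[OF bounded_linear_im_part]
        C_k_on_linear[OF bounded_linear_fst] C_k_on_linear[OF bounded_linear_snd] C_k_on_id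
        open_UNIV)
  have bij: "smooth_bij U V \<phi>"
    by (rule smooth_bijI[where U = UNIV and V = UNIV and f' = \<phi> and g = \<psi>])
      (auto simp: C\<phi> C\<psi> \<psi>\<phi> \<phi>\<psi> U_def V_def)
  have "open U" "open V"
    unfolding U_def V_def re_part_def
    by (intro open_Collect_less continuous_intros C_k_on_imp_continuous_on[OF C\<phi>])+
  \<comment> \<open>Cancellation with a = r leaves only the radial factor in the first
    component.\<close>
  have \<phi>_log: "\<phi> (r *\<^sub>R unit_exp p, p) = (r *\<^sub>R 1, p)" if "p \<in> imaginary" for r p
    using unit_exp_cancel[OF that, of "r *\<^sub>R 1"] that
    by (simp add: \<phi>_def im_part_of_imaginary nda_scaleR_mult nda_one_mult)
  have sub: "log_manifold \<subseteq> U"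
    by (auto simp: U_def log_manifold_conv[OF assms] \<phi>_log re_part_scaleR re_part_one)
  have W: "W = {(r *\<^sub>R 1, p) | r p. p \<in> imaginary}"
  proof (intro equalityI subsetI)
    fix z :: "'k \<times> 'k" assume "z \<in> {(r *\<^sub>R 1, p) | r p. p \<in> imaginary}"
    then obtain r p where "z = (r *\<^sub>R 1, p)" "p \<in> imaginary" by blast
    then show "z \<in> W"
      unfolding W_def by (intro image_eqI[of _ _ "r *\<^sub>R 1 + p"]) (auto simp: re_part_decomp im_part_decomp)
  qed (use im_part_imaginary in \<open>auto simp: W_def\<close>)
  have "\<phi> ` log_manifold = V \<inter> W"
  proof (intro equalityI subsetI)
    fix z assume "z \<in> \<phi> ` log_manifold"
    then show "z \<in> V \<inter> W"
      by (auto simp: V_def W log_manifold_conv[OF assms] \<phi>_log re_part_scaleR re_part_one)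
  next
    fix z assume "z \<in> V \<inter> W"
    then obtain r p where z: "z = (r *\<^sub>R 1, p)" "p \<in> imaginary"
      unfolding W by blast
    moreover have "r > 0"
      using \<open>z \<in> V \<inter> W\<close> by (simp add: z V_def re_part_scaleR re_part_one)
    ultimately show "z \<in> \<phi> ` log_manifold"
      by (intro image_eqI[of _ _ "(r *\<^sub>R unit_exp p, p)"])
        (auto simp: \<phi>_log log_manifold_conv[OF assms])
  qed
  with sub have im: "\<phi> ` (log_manifold \<inter> U) = V \<inter> W"
    by (simp add: Int_absorb2)
  have lin: "linear (\<lambda>q::'k. (re_part q *\<^sub>R 1 :: 'k, im_part q))"
    using bounded_linear_re_part bounded_linear_im_part
    by (intro bounded_linear.linear bounded_linear_Pair
        bounded_linear_compose[OF bounded_linear_scaleR_left])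
  moreover have "inj (\<lambda>q::'k. (re_part q *\<^sub>R 1 :: 'k, im_part q))"
    by (rule injI) (metis prod.inject re_im_decomp)
  ultimately have "dim W = DIM('k)"
    unfolding W_def by (simp add: dim_image_eq dim_UNIV)
  moreover have "subspace W"
    unfolding W_def using lin by (intro linear_subspace_image subspace_UNIV)
  \<comment> \<open>The same chart serves every point, since U contains the whole manifold.\<close>
  ultimately show ?thesis
    unfolding embedded_submanifold_def
    using sub \<open>open U\<close> \<open>open V\<close> bij im
    by - (rule ballI, rule exI[of _ U], rule exI[of _ V], rule exI[of _ W], rule exI[of _ \<phi>],
        simp add: subsetD)
qed

lemma diffeomorphism_E_log:
  assumes "(imag_units :: 'k::normed_division_algebra set) \<noteq> {}"
  shows "diffeomorphism log_manifold (UNIV :: 'k set) E_log"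
  unfolding diffeomorphism_def
  using embedded_submanifold_log_manifold[OF assms] embedded_submanifold_UNIV
    smooth_bij_E_log[OF assms] by blast

theorem proposition5p4:
  shows
    "(E_exp \<in> (UNIV :: quat set) \<rightarrow> log_manifold \<and>
      (\<forall>q::quat. E_log (E_exp q) = q) \<and>
      (\<forall>z\<in>(log_manifold :: (quat \<times> quat) set). E_exp (E_log z) = z) \<and>
      diffeomorphism log_manifold (UNIV :: quat set) E_log) \<and>
     (E_exp \<in> (UNIV :: octo set) \<rightarrow> log_manifold \<and>
      (\<forall>q::octo. E_log (E_exp q) = q) \<and>
      (\<forall>z\<in>(log_manifold :: (octo \<times> octo) set). E_exp (E_log z) = z) \<and>
      diffeomorphism log_manifold (UNIV :: octo set) E_log)"
  \<comment> \<open>Both algebras are instances of the general results, which ask only for an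
    imaginary unit.\<close>
  by (simp add: imag_units_nonempty E_exp_in_log_manifold E_log_E_exp E_exp_E_log
      diffeomorphism_E_log)

end
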